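(* Let $E$ be an $n$-dimensional complex nilpotent evolution algebra satisfying the condition $P$. Then there exist an integer $k$ with $1\le k\le n$ and an algebra $\widetilde{E}\in ZN^{k}$ such that $E$ is isomorphic to $\widetilde{E}\oplus\mathbb{C}^{n-k}$.
   Context: All algebras are finite dimensional over $\mathbb{C}$ (not necessarily associative). An evolution algebra is an algebra $E$ admitting a basis $\{e_1,\dots,e_n\}$ (called a natural basis) with $e_i\cdot e_j=0$ for $i\ne j$ and $e_i\cdot e_i=\sum_{k}a_{ik}e_k$ for all $i$; $A=(a_{ij})$ is the matrix of structural constants of $E$ in this basis. A natural basis of an evolution algebra $E$ is any vector space basis of $E$ whose distinct elements multiply to zero. Condition $P$: an evolution algebra $E$ satisfies the condition $P$ if every subalgebra $M$ of $E$ (linear subspace closed under multiplication) has a basis consisting of elements with pairwise zero products (a natural basis of $M$) which can be extended to a natural basis of $E$. Nilpotency: put $E^1=E$ and $E^{k}=\sum_{i=1}^{k-1}E^iE^{k-i}$ for $k\ge 2$; $E$ is nilpotent if $E^m=0$ for some $m\in\mathbb{N}$. $\mathbb{C}^m$ denotes the $m$-dimensional algebra with zero multiplication, and $\oplus$ denotes the direct sum of algebras (products between different summands are zero). $ZN^{k}$ denotes the set of all $k$-dimensional evolution algebras whose matrix of structural constants $(a_{ij})_{1\le i,j\le k}$ in some natural basis satisfies: $a_{ij}=0$ for $j\le i$; $a_{i,i+1}=1$ for $1\le i\le k-1$; $a_{i,k}=0$ for $1\le i\le k-2$; the remaining entries $a_{ij}$ with $i+2\le j\le k-1$ are arbitrary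 complex numbers. (For $k=1$ this is the one-dimensional algebra with zero multiplication.) That is, the matrix is \[\begin{pmatrix} 0 & 1 & a_{13} &\dots &a_{1,k-1}&0 \\ 0 & 0 & 1 &\dots &a_{2,k-1}& 0 \\ 0 & 0 & 0 &\dots &a_{3,k-1}& 0 \\ \vdots & \vdots & \vdots &\cdots & \vdots &\vdots\\ 0 & 0 & 0 &\cdots & 0& 1\\ 0 & 0 & 0 &\cdots &0 & 0 \end{pmatrix}.\] *)

theory Defs
  imports Complex_Main "HOL-Library.Function_Algebras" "HOL-Library.Product_Plus"
begin

text \<open>
  An algebra is carried by a linear subspace of an ambient complex vector space (possibly all of
  it), so that algebras of every finite dimension live in one type and a subalgebra is obtained by
  shrinking the carrier. The product is only constrained on the carrier.
\<close>

record 'a calg =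
  carr :: "'a set"
  scl :: "complex \<Rightarrow> 'a \<Rightarrow> 'a"
  prd :: "'a \<Rightarrow> 'a \<Rightarrow> 'a"

locale complex_algebra = vector_space "scl E" for E :: "'a::ab_group_add calg" +
  assumes subspace_carr: "subspace (carr E)"
    and finite_dim: "\<exists>B. finite B \<and> span B = carr E"
    and prd_closed: "\<lbrakk>x \<in> carr E; y \<in> carr E\<rbrakk> \<Longrightarrow> prd E x y \<in> carr E"
    and prd_add_left: "\<lbrakk>x \<in> carr E; y \<in> carr E; z \<in> carr E\<rbrakk>
          \<Longrightarrow> prd E (x + y) z = prd E x z + prd E y z"
    and prd_add_right: "\<lbrakk>x \<in> carr E; y \<in> carr E; z \<in> carr E\<rbrakk>
          \<Longrightarrow> prd E x (y + z) = prd E x y + prd E x z"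
    and prd_scl_left: "\<lbrakk>x \<in> carr E; y \<in> carr E\<rbrakk> \<Longrightarrow> prd E (scl E c x) y = scl E c (prd E x y)"
    and prd_scl_right: "\<lbrakk>x \<in> carr E; y \<in> carr E\<rbrakk> \<Longrightarrow> prd E x (scl E c y) = scl E c (prd E x y)"

definition alg_dim :: "'a::ab_group_add calg \<Rightarrow> nat" where
  "alg_dim E = vector_space.dim (scl E) (carr E)"

definition natural_basis :: "'a::ab_group_add calg \<Rightarrow> 'a set \<Rightarrow> bool" where
  "natural_basis E B \<longleftrightarrow>
     \<not> module.dependent (scl E) B \<and> module.span (scl E) B = carr E \<and>
     (\<forall>x\<in>B. \<forall>y\<in>B. x \<noteq> y \<longrightarrow> prd E x y = 0)"

definition evolution_algebra :: "'a::ab_group_add calg \<Rightarrow> bool" where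
  "evolution_algebra E \<longleftrightarrow> complex_algebra E \<and> (\<exists>B. natural_basis E B)"

definition subalgebra :: "'a::ab_group_add set \<Rightarrow> 'a calg \<Rightarrow> bool" where
  "subalgebra M E \<longleftrightarrow>
     M \<subseteq> carr E \<and> module.subspace (scl E) M \<and> (\<forall>x\<in>M. \<forall>y\<in>M. prd E x y \<in> M)"

definition condition_P :: "'a::ab_group_add calg \<Rightarrow> bool" where
  "condition_P E \<longleftrightarrow>
     (\<forall>M. subalgebra M E \<longrightarrow>
        (\<exists>B C. natural_basis (E\<lparr>carr := M\<rparr>) B \<and> natural_basis E C \<and> B \<subseteq> C))"

definition subspace_prd :: "'a::ab_group_add calg \<Rightarrow> 'a set \<Rightarrow> 'a set \<Rightarrow> 'a set" where
  "subspace_prd E S T = module.span (scl E) {prd E x y | x y. x \<in> S \<and> y \<in> T}"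

text \<open>
  The sum of the subspaces \<open>E\<^sup>i E\<^sup>k\<^sup>-\<^sup>i\<close> is the span of their union. The value at
  exponent 0 is a dummy.
\<close>

function alg_power :: "'a::ab_group_add calg \<Rightarrow> nat \<Rightarrow> 'a set" where
  "alg_power E k =
     (if k \<le> 1 then carr E
      else module.span (scl E)
             (\<Union>i\<in>{1..k-1}. subspace_prd E (alg_power E i) (alg_power E (k - i))))"
  by auto
termination
  by (relation "measure snd") auto

declare alg_power.simps [simp del]

definition nilpotent_alg :: "'a::ab_group_add calg \<Rightarrow> bool" where
  "nilpotent_alg E \<longleftrightarrow> (\<exists>m\<ge>1. alg_power E m = {0})"

definition structure_matrix ::
    "'a::ab_group_add calg \<Rightarrow> nat \<Rightarrow> (nat \<Rightarrow> 'a) \<Rightarrow> (nat \<Rightarrow> nat \<Rightarrow> complex) \<Rightarrow> bool" where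
  "structure_matrix E k e a \<longleftrightarrow>
     inj_on e {1..k} \<and> natural_basis E (e ` {1..k}) \<and>
     (\<forall>i\<in>{1..k}. prd E (e i) (e i) = (\<Sum>j=1..k. scl E (a i j) (e j)))"

definition ZN :: "nat \<Rightarrow> 'a::ab_group_add calg set" where
  "ZN k = {E. evolution_algebra E \<and>
     (\<exists>e a. structure_matrix E k e a \<and>
        (\<forall>i\<in>{1..k}. \<forall>j\<in>{1..k}. j \<le> i \<longrightarrow> a i j = 0) \<and>
        (\<forall>i. 1 \<le> i \<and> i + 1 \<le> k \<longrightarrow> a i (i + 1) = 1) \<and>
        (\<forall>i. 1 \<le> i \<and> i + 2 \<le> k \<longrightarrow> a i k = 0))}"

text \<open>The space of \<open>m\<close>-tuples, as functions vanishing outside \<open>{..<m}\<close>, with zero product.\<close>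

definition null_alg :: "nat \<Rightarrow> (nat \<Rightarrow> complex) calg" where
  "null_alg m = \<lparr>carr = {v. \<forall>i\<ge>m. v i = 0}, scl = (\<lambda>c v i. c * v i), prd = (\<lambda>v w. 0)\<rparr>"

definition direct_sum ::
    "'a calg \<Rightarrow> 'b calg \<Rightarrow> ('a \<times> 'b) calg"  (infixr "\<oplus>\<^sub>a" 65) where
  "E \<oplus>\<^sub>a F = \<lparr>carr = carr E \<times> carr F,
     scl = (\<lambda>c x. (scl E c (fst x), scl F c (snd x))),
     prd = (\<lambda>x y. (prd E (fst x) (fst y), prd F (snd x) (snd y)))\<rparr>"

definition alg_iso :: "'a::ab_group_add calg \<Rightarrow> 'b::ab_group_add calg \<Rightarrow> bool"  (infix "\<cong>\<^sub>a" 50) where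
  "E \<cong>\<^sub>a F \<longleftrightarrow> (\<exists>f. bij_betw f (carr E) (carr F) \<and>
     (\<forall>x\<in>carr E. \<forall>y\<in>carr E. f (x + y) = f x + f y) \<and>
     (\<forall>c. \<forall>x\<in>carr E. f (scl E c x) = scl F c (f x)) \<and>
     (\<forall>x\<in>carr E. \<forall>y\<in>carr E. f (prd E x y) = prd F (f x) (f y)))"

end

theory Submission
  imports Defs
begin

text \<open>
  An element \<open>x\<close> that belongs to some natural basis \<open>C\<close> satisfies \<open>x y \<in> \<complex> x\<^sup>2\<close> for all \<open>y\<close>:
  multiplying by a basis vector only sees the corresponding coordinate. This makes condition \<open>P\<close>
  very restrictive, and two kinds of subalgebras suffice to exploit it. Fix a natural basis and
  consider the vectors in it with nonzero square; the others span the annihilator \<open>A\<close>.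

  If \<open>x\<^sup>2 = 0\<close>, then the line \<open>\<complex> x\<close> is a subalgebra, so a multiple of \<open>x\<close> lies in a natural basis and
  \<open>x\<close> annihilates everything (\<open>sq_zero_imp_annihilator\<close>). Since complex numbers have square roots, a
  linear relation between the nonzero squares of basis vectors is the vanishing of some \<open>x\<^sup>2\<close>.
  Hence these squares are linearly independent.

  If \<open>x\<^sup>2 \<in> A\<close>, then \<open>x\<close> and \<open>x\<^sup>2\<close> span a subalgebra, so some \<open>x + q x\<^sup>2\<close> lies, up to a factor, in a
  natural basis. Its products with the algebra fill at most a line, and by independence of the
  squares \<open>x\<close> has at most one nonzero coordinate outside \<open>A\<close> (\<open>sq_annihilator_one_coord\<close>). Taking
  square roots of coefficients again, once one of the squares lies in \<open>A\<close> the others are independent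
  modulo \<open>A\<close> (\<open>squares_independent_mod_annihilator\<close>).

  Nilpotency orders the non-annihilating basis vectors as \<open>s\<^sub>1, \<dots>, s\<^sub>r\<close> so that \<open>s\<^sub>i\<^sup>2\<close> lies in
  \<open>A + \<langle>s\<^sub>i\<^sub>+\<^sub>1, \<dots>, s\<^sub>r\<rangle>\<close>; in particular \<open>s\<^sub>r\<^sup>2 \<in> A\<close>. As \<open>s\<^sub>1\<^sup>2, \<dots>, s\<^sub>r\<^sub>-\<^sub>1\<^sup>2\<close> are independent modulo \<open>A\<close>, a
  triangular matrix of full rank appears: its diagonal, the superdiagonal of the structure matrix,
  has no zero, and \<open>s\<^sub>2, \<dots>, s\<^sub>r\<close> lie in \<open>A + Q\<close>, where \<open>Q = \<langle>s\<^sub>1\<^sup>2, \<dots>, s\<^sub>r\<^sub>-\<^sub>1\<^sup>2\<rangle>\<close> meets \<open>A\<close> only in 0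
  (\<open>flag_in_span_squares\<close>). Replacing every \<open>s\<^sub>j\<close> with \<open>j \<ge> 2\<close> by its component in \<open>Q\<close> changes no product and
  removes the parts in \<open>A\<close> from the squares of \<open>s\<^sub>1, \<dots>, s\<^sub>r\<^sub>-\<^sub>1\<close>. Adding \<open>s\<^sub>r\<^sup>2\<close> as the last vector of the
  chain, of length \<open>k = r + 1\<close>, completing it by a basis of \<open>A\<close> and rescaling gives the asserted
  matrix (\<open>ex_structure_matrix_superdiagonal\<close>).
\<close>

section \<open>Orderings and linear combinations\<close>

text \<open>
  Topological sorting: a relation in which every nonempty subset contains an element unrelated to
  all of the subset becomes strictly increasing for a suitable enumeration, obtained by repeatedly
  putting a sink last. It turns nilpotency into a triangular structure matrix.
\<close>

lemma ordering_from_sinks: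
  assumes "finite S"
    and "\<And>T. T \<subseteq> S \<Longrightarrow> T \<noteq> {} \<Longrightarrow> \<exists>t\<in>T. \<forall>u\<in>T. \<not> R t u"
  shows "\<exists>s. bij_betw s {1..card S} S \<and>
    (\<forall>i\<in>{1..card S}. \<forall>j\<in>{1..card S}. j \<le> i \<longrightarrow> \<not> R (s i) (s j))"
  using assms
proof (induction "card S" arbitrary: S)
  case 0
  then show ?case by (simp add: bij_betw_def)
next
  case (Suc r)
  then have "S \<noteq> {}" by auto
  then obtain t where t: "t \<in> S" "\<forall>u\<in>S. \<not> R t u" using Suc.prems(2)[of S] by auto
  have card: "card (S - {t}) = r" using Suc.hyps(2) t Suc.prems(1) by simp
  have "\<exists>s. bij_betw s {1..card (S - {t})} (S - {t}) \<and>
    (\<forall>i\<in>{1..card (S - {t})}. \<forall>j\<in>{1..card (S - {t})}. j \<le> i \<longrightarrow> \<not> R (s i) (s j))"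
  proof (rule Suc.hyps(1))
    show "\<exists>t\<in>T. \<forall>u\<in>T. \<not> R t u" if "T \<subseteq> S - {t}" "T \<noteq> {}" for T
      using Suc.prems(2)[of T] that by blast
  qed (use card Suc.prems(1) in simp_all)
  then obtain s where s: "bij_betw s {1..r} (S - {t})"
    "\<forall>i\<in>{1..r}. \<forall>j\<in>{1..r}. j \<le> i \<longrightarrow> \<not> R (s i) (s j)"
    unfolding card by blast
  let ?s = "s(Suc r := t)"
  have "bij_betw ?s {1..r} (S - {t})"
    using s(1) by (subst bij_betw_cong[of _ _ s]) auto
  then have "bij_betw ?s ({1..r} \<union> {Suc r}) ((S - {t}) \<union> {t})"
    by (rule bij_betw_combine) (auto simp: bij_betw_def)
  moreover have "{1..r} \<union> {Suc r} = {1..Suc r}" "(S - {t}) \<union> {t} = S" using t by auto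
  ultimately have bij: "bij_betw ?s {1..Suc r} S" by simp
  have "\<not> R (?s i) (?s j)" if "i \<in> {1..Suc r}" "j \<in> {1..Suc r}" "j \<le> i" for i j
  proof (cases "i = Suc r")
    case True
    then show ?thesis using t(2) bij that by (auto simp: bij_betw_def)
  next
    case False
    then show ?thesis using s(2) that by auto
  qed
  then show ?case using bij unfolding Suc.hyps(2)[symmetric] by blast
qed

lemma (in module) span_image_lincomb:
  assumes "finite I" "v \<in> span (f ` I)"
  shows "\<exists>c. v = (\<Sum>i\<in>I. c i *s f i)"
  using assms
proof (induction I arbitrary: v rule: finite_induct)
  case empty
  then show ?case by simp
next
  case (insert i I)
  then obtain k where "v - k *s f i \<in> span (f ` I)" using span_breakdown_eq by auto
  then obtain c where c: "v - k *s f i = (\<Sum>i\<in>I. c i *s f i)" using insert by blast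
  have "(\<Sum>j\<in>I. (c(i:=k)) j *s f j) = (\<Sum>i\<in>I. c i *s f i)"
    using insert.hyps by (intro sum.cong) auto
  then have "v = (\<Sum>j\<in>insert i I. (c(i:=k)) j *s f j)"
    using insert.hyps c by (simp add: algebra_simps)
  then show ?case by blast
qed

section \<open>Products, annihilator and structure matrices\<close>

context complex_algebra
begin

lemma prd_zero_left: "y \<in> carr E \<Longrightarrow> prd E 0 y = 0"
  using prd_scl_left[of 0 y 0] subspace_0[OF subspace_carr] by simp

lemma prd_zero_right: "y \<in> carr E \<Longrightarrow> prd E y 0 = 0"
  using prd_scl_right[of y 0 0] subspace_0[OF subspace_carr] by simp

lemma prd_sum_left:
  assumes "\<And>i. i \<in> I \<Longrightarrow> f i \<in> carr E" "y \<in> carr E"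
  shows "prd E (\<Sum>i\<in>I. f i) y = (\<Sum>i\<in>I. prd E (f i) y)"
  using assms(1)
proof (induction I rule: infinite_finite_induct)
  case (insert i I)
  then show ?case
    using prd_add_left[of "f i" "sum f I" y] subspace_sum[OF subspace_carr, of I f] assms(2) by simp
qed (use assms(2) prd_zero_left in auto)

lemma prd_sum_right:
  assumes "\<And>i. i \<in> I \<Longrightarrow> f i \<in> carr E" "y \<in> carr E"
  shows "prd E y (\<Sum>i\<in>I. f i) = (\<Sum>i\<in>I. prd E y (f i))"
  using assms(1)
proof (induction I rule: infinite_finite_induct)
  case (insert i I)
  then show ?case
    using prd_add_right[of y "f i" "sum f I"] subspace_sum[OF subspace_carr, of I f] assms(2) by simp
qed (use assms(2) prd_zero_right in auto)

definition annihilator :: "'a set" where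
  "annihilator = {x \<in> carr E. \<forall>y\<in>carr E. prd E x y = 0}"

lemma subspace_annihilator: "subspace annihilator"
  using subspace_carr
  by (auto simp: subspace_def annihilator_def prd_zero_left prd_add_left prd_scl_left)

lemma carr_scl: "x \<in> carr E \<Longrightarrow> scl E c x \<in> carr E"
  using subspace_scale[OF subspace_carr] .

lemma finite_independent_carr:
  assumes "independent B" "B \<subseteq> carr E"
  shows "finite B"
  using finite_dim independent_span_bound assms by metis

lemma prd_mem_alg_power_Suc:
  assumes "m \<ge> 1" "x \<in> alg_power E m" "y \<in> carr E"
  shows "prd E x y \<in> alg_power E (Suc m)"
proof -
  have "prd E x y \<in> subspace_prd E (alg_power E m) (alg_power E (Suc m - m))"
    using assms unfolding subspace_prd_def
    by (intro span_base) (use alg_power.simps[of E "Suc 0"] in auto)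
  then show ?thesis
    using assms(1) by (subst alg_power.simps) (auto intro!: span_base bexI[of _ m])
qed

lemma alg_power_scl:
  assumes "m \<ge> 2" "x \<in> alg_power E m"
  shows "scl E c x \<in> alg_power E m"
  using assms by (subst (asm) alg_power.simps, subst alg_power.simps) (auto intro: span_scale)

text \<open>
  A spanning family of \<open>n\<close> vectors in dimension \<open>n\<close> is a basis, so independence and injectivity of the
  indexing come for free.
\<close>

lemma structure_matrixI:
  assumes "span (g ` {1..n}) = carr E" "dim (carr E) = n"
    and "\<And>i j. i \<in> {1..n} \<Longrightarrow> j \<in> {1..n} \<Longrightarrow> i \<noteq> j \<Longrightarrow> prd E (g i) (g j) = 0"
    and "\<And>i. i \<in> {1..n} \<Longrightarrow> prd E (g i) (g i) = (\<Sum>j=1..n. scl E (a i j) (g j))"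
  shows "structure_matrix E n g a"
proof -
  have le: "card (g ` {1..n}) \<le> n" using card_image_le[of "{1..n}" g] by simp
  have "dim (carr E) \<le> card (g ` {1..n})" using assms(1) by (intro dim_le_card) auto
  then have eq: "card (g ` {1..n}) = n" using le assms(2) by simp
  then have "inj_on g {1..n}" by (intro eq_card_imp_inj_on) auto
  moreover have "independent (g ` {1..n})"
  proof -
    obtain D where D: "D \<subseteq> g ` {1..n}" "independent D" "g ` {1..n} \<subseteq> span D"
      using maximal_independent_subset by blast
    then have "span D = carr E"
      using assms(1) by (metis span_mono span_span subset_antisym)
    then have "card D = n" using dim_eq_card[of D "carr E"] D assms(2) span_span[of D] by metis
    then have "D = g ` {1..n}" using eq D(1) by (intro card_subset_eq) auto
    then show ?thesis using D by simp
  qed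
  moreover have "prd E x y = 0"
    if xy: "x \<in> g ` {1..n}" "y \<in> g ` {1..n}" "x \<noteq> y" for x y
  proof -
    obtain i j where ij: "i \<in> {1..n}" "x = g i" "j \<in> {1..n}" "y = g j" using xy by blast
    then show ?thesis using assms(3)[of i j] xy(3) by blast
  qed
  ultimately show ?thesis
    unfolding structure_matrix_def natural_basis_def by (intro conjI ballI impI assms(1,4)) 
qed

lemma structure_matrix_rescale:
  assumes f: "structure_matrix E n f a" and l: "\<And>i. i \<in> {1..n} \<Longrightarrow> l i \<noteq> 0"
    and n: "dim (carr E) = n"
  shows "structure_matrix E n (\<lambda>i. scl E (l i) (f i)) (\<lambda>i j. (l i)\<^sup>2 * a i j / l j)"
proof -
  let ?g = "\<lambda>i. scl E (l i) (f i)"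
  have inj: "inj_on f {1..n}" and span: "span (f ` {1..n}) = carr E"
    and sq: "\<And>i. i \<in> {1..n} \<Longrightarrow> prd E (f i) (f i) = (\<Sum>j=1..n. scl E (a i j) (f j))"
    and orth0: "\<forall>x\<in>f ` {1..n}. \<forall>y\<in>f ` {1..n}. x \<noteq> y \<longrightarrow> prd E x y = 0"
    using f unfolding structure_matrix_def natural_basis_def by blast+
  have orth: "prd E (f i) (f j) = 0" if "i \<in> {1..n}" "j \<in> {1..n}" "i \<noteq> j" for i j
    using orth0 inj_onD[OF inj, of i j] that by blast
  have fc: "f i \<in> carr E" if "i \<in> {1..n}" for i using span that span_superset by blast
  have "?g ` {1..n} \<subseteq> span (f ` {1..n})"
    by (intro image_subsetI span_scale span_base imageI)
  moreover have "f i \<in> span (?g ` {1..n})" if "i \<in> {1..n}" for i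
  proof -
    have "f i = scl E (inverse (l i)) (?g i)" using l that by simp
    then show ?thesis using that by (metis (no_types, lifting) imageI span_base span_scale)
  qed
  ultimately have "span (?g ` {1..n}) = carr E"
    unfolding span[symmetric] by (intro subset_antisym span_minimal) auto
  then show ?thesis
  proof (rule structure_matrixI[OF _ n])
    fix i j assume "i \<in> {1..n}" "j \<in> {1..n}" "i \<noteq> j"
    then show "prd E (?g i) (?g j) = 0"
      using orth fc by (simp add: prd_scl_left prd_scl_right carr_scl)
  next
    fix i assume i: "i \<in> {1..n}"
    have "prd E (?g i) (?g i) = scl E ((l i)\<^sup>2) (\<Sum>j=1..n. scl E (a i j) (f j))"
      using i fc sq by (simp add: prd_scl_left prd_scl_right carr_scl power2_eq_square)
    also have "\<dots> = (\<Sum>j=1..n. scl E ((l i)\<^sup>2 * a i j / l j) (?g j))"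
      unfolding scale_sum_right using l by (intro sum.cong) auto
    finally show "prd E (?g i) (?g i) = (\<Sum>j=1..n. scl E ((l i)\<^sup>2 * a i j / l j) (?g j))" .
  qed
qed

end

section \<open>Coordinates with respect to a natural basis\<close>

locale evolution_basis = complex_algebra E for E :: "'a::ab_group_add calg" +
  fixes B :: "'a set"
  assumes natural: "natural_basis E B"
begin

lemma independent_B: "independent B" and span_B: "span B = carr E"
  and orth: "x \<in> B \<Longrightarrow> y \<in> B \<Longrightarrow> x \<noteq> y \<Longrightarrow> prd E x y = 0"
  using natural unfolding natural_basis_def by auto

lemma B_carr: "b \<in> B \<Longrightarrow> b \<in> carr E"
  using span_B span_superset by blast

lemma finite_B: "finite B"
  using finite_independent_carr independent_B B_carr by blast

abbreviation coord :: "'a \<Rightarrow> 'a \<Rightarrow> complex" where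
  "coord \<equiv> representation B"

lemma coord_expansion: "x \<in> carr E \<Longrightarrow> (\<Sum>b\<in>B. scl E (coord x b) b) = x"
  using sum_representation_eq independent_B span_B finite_B by blast

lemma coord_add: "x \<in> carr E \<Longrightarrow> y \<in> carr E \<Longrightarrow> coord (x + y) b = coord x b + coord y b"
  using representation_add[OF independent_B] span_B by metis

lemma coord_diff: "x \<in> carr E \<Longrightarrow> y \<in> carr E \<Longrightarrow> coord (x - y) b = coord x b - coord y b"
  using representation_diff[OF independent_B] span_B by metis

lemma coord_scl: "x \<in> carr E \<Longrightarrow> coord (scl E c x) b = c * coord x b"
  using representation_scale[OF independent_B] span_B by metis

lemma coord_sum:
  "(\<And>i. i \<in> I \<Longrightarrow> v i \<in> carr E) \<Longrightarrow> coord (\<Sum>i\<in>I. v i) b = (\<Sum>i\<in>I. coord (v i) b)"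
  using representation_sum[OF independent_B, of I v] span_B by metis

lemma coord_basis: "b \<in> B \<Longrightarrow> coord b c = (if c = b then 1 else 0)"
  using representation_basis[OF independent_B] by metis

lemma coord_lincomb:
  assumes "T \<subseteq> B" "b \<in> B"
  shows "coord (\<Sum>c\<in>T. scl E (f c) c) b = (if b \<in> T then f b else 0)"
proof -
  have fin: "finite T" using assms finite_B finite_subset by blast
  have "coord (\<Sum>c\<in>T. scl E (f c) c) b = (\<Sum>c\<in>T. f c * coord c b)"
    using assms B_carr by (subst coord_sum) (auto simp: carr_scl coord_scl subset_iff)
  also have "\<dots> = (\<Sum>c\<in>T. if b = c then f c else 0)"
    using assms by (intro sum.cong) (auto simp: coord_basis subset_iff)
  also have "\<dots> = (if b \<in> T then f b else 0)" using fin by simp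
  finally show ?thesis .
qed

lemma lincomb_carr: "T \<subseteq> B \<Longrightarrow> (\<Sum>c\<in>T. scl E (f c) c) \<in> carr E"
  using B_carr by (intro subspace_sum subspace_carr) (auto simp: carr_scl)

text \<open>
  This is the property that condition \<open>P\<close> is tested against: a member of a natural basis multiplies
  the algebra into the line through its square.
\<close>

lemma prd_basis_left:
  assumes "b \<in> B" "y \<in> carr E"
  shows "prd E b y = scl E (coord y b) (prd E b b)"
proof -
  have "prd E b y = prd E b (\<Sum>c\<in>B. scl E (coord y c) c)" using coord_expansion assms by simp
  also have "\<dots> = (\<Sum>c\<in>B. scl E (coord y c) (prd E b c))"
    using assms B_carr by (subst prd_sum_right) (auto simp: carr_scl prd_scl_right)
  also have "\<dots> = (\<Sum>c\<in>B. if b = c then scl E (coord y c) (prd E b b) else 0)"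
    using assms orth by (intro sum.cong) auto
  also have "\<dots> = scl E (coord y b) (prd E b b)" using assms finite_B by simp
  finally show ?thesis .
qed

lemma prd_expansion:
  assumes "x \<in> carr E" "y \<in> carr E"
  shows "prd E x y = (\<Sum>b\<in>B. scl E (coord x b * coord y b) (prd E b b))"
proof -
  have "prd E x y = prd E (\<Sum>b\<in>B. scl E (coord x b) b) y" using coord_expansion assms by simp
  also have "\<dots> = (\<Sum>b\<in>B. scl E (coord x b) (prd E b y))"
    using assms B_carr by (subst prd_sum_left) (auto simp: carr_scl prd_scl_left)
  also have "\<dots> = (\<Sum>b\<in>B. scl E (coord x b * coord y b) (prd E b b))"
    using prd_basis_left assms by (intro sum.cong) auto
  finally show ?thesis .
qed

lemma prd_comm: "x \<in> carr E \<Longrightarrow> y \<in> carr E \<Longrightarrow> prd E x y = prd E y x"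
  using prd_expansion[of x y] prd_expansion[of y x] by (simp only: mult.commute[of "coord x _"])

lemma prd_basis_right:
  "b \<in> B \<Longrightarrow> y \<in> carr E \<Longrightarrow> prd E y b = scl E (coord y b) (prd E b b)"
  using prd_basis_left[of b y] prd_comm[of y b] B_carr by metis

definition nonnull :: "'a set" where
  "nonnull = {b \<in> B. prd E b b \<noteq> 0}"

lemma nonnull_B: "b \<in> nonnull \<Longrightarrow> b \<in> B" and nonnull_subset: "nonnull \<subseteq> B" and finite_nonnull: "finite nonnull"
  and nonnull_carr: "b \<in> nonnull \<Longrightarrow> b \<in> carr E"
  using finite_B B_carr by (auto simp: nonnull_def)

lemma sq_carr: "b \<in> nonnull \<Longrightarrow> prd E b b \<in> carr E"
  using prd_closed nonnull_carr by blast

lemma prd_expansion_nonnull: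
  assumes "x \<in> carr E" "y \<in> carr E"
  shows "prd E x y = (\<Sum>b\<in>nonnull. scl E (coord x b * coord y b) (prd E b b))"
  unfolding prd_expansion[OF assms]
  by (rule sum.mono_neutral_right) (auto simp: finite_B nonnull_def)

lemma annihilator_iff: "x \<in> annihilator \<longleftrightarrow> x \<in> carr E \<and> (\<forall>b\<in>nonnull. coord x b = 0)"
proof
  assume x: "x \<in> annihilator"
  have "coord x b = 0" if "b \<in> nonnull" for b
    using prd_basis_right[of b x] x that B_carr by (auto simp: annihilator_def nonnull_def)
  then show "x \<in> carr E \<and> (\<forall>b\<in>nonnull. coord x b = 0)" using x by (auto simp: annihilator_def)
next
  assume x: "x \<in> carr E \<and> (\<forall>b\<in>nonnull. coord x b = 0)"
  then have "prd E x y = 0" if "y \<in> carr E" for y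
    using that prd_expansion_nonnull[of x y] by simp
  then show "x \<in> annihilator" using x by (simp add: annihilator_def)
qed

lemma annihilator_carr: "x \<in> annihilator \<Longrightarrow> x \<in> carr E"
  by (simp add: annihilator_def)

lemma annihilator_span: "annihilator = span (B - nonnull)"
proof
  show "annihilator \<subseteq> span (B - nonnull)"
  proof
    fix x assume x: "x \<in> annihilator"
    then have "x = (\<Sum>b\<in>B. scl E (coord x b) b)"
      using coord_expansion annihilator_carr by simp
    also have "\<dots> = (\<Sum>b\<in>B-nonnull. scl E (coord x b) b)"
      using x by (intro sum.mono_neutral_right) (auto simp: finite_B annihilator_iff)
    finally show "x \<in> span (B - nonnull)" using span_sum span_scale span_base by (metis (no_types, lifting))
  qed
  show "span (B - nonnull) \<subseteq> annihilator"
    by (intro span_minimal subspace_annihilator)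
      (auto simp: annihilator_iff B_carr coord_basis nonnull_def split: if_splits)
qed

lemma diff_nonnull_part_annihilator:
  assumes "x \<in> carr E"
  shows "x - (\<Sum>b\<in>nonnull. scl E (coord x b) b) \<in> annihilator"
  using assms lincomb_carr[OF nonnull_subset] nonnull_subset subspace_diff[OF subspace_carr]
  by (auto simp: annihilator_iff coord_diff coord_lincomb subset_iff)

text \<open>
  If \<open>t\<^sup>2\<close> has a nonzero coordinate at \<open>u\<close>, then \<open>u\<^sup>2\<close> is a multiple of \<open>t\<^sup>2 u\<close> and lies one step deeper in
  the power filtration than \<open>t\<^sup>2\<close>. Without a sink this could be repeated for ever inside \<open>T\<close>, and a
  nonzero square would lie in a vanishing power.
\<close>

lemma sink_exists:
  assumes "nilpotent_alg E" "T \<subseteq> nonnull" "T \<noteq> {}"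
  shows "\<exists>t\<in>T. \<forall>u\<in>T. coord (prd E t t) u = 0"
proof (rule ccontr)
  assume "\<not> ?thesis"
  then have next_elt: "\<exists>u\<in>T. coord (prd E t t) u \<noteq> 0" if "t \<in> T" for t using that by blast
  have "\<exists>t\<in>T. prd E t t \<in> alg_power E m" if "m \<ge> 1" for m
    using that
  proof (induction m rule: dec_induct)
    case base
    have "alg_power E 1 = carr E" by (subst alg_power.simps) simp
    then show ?case using assms sq_carr by auto
  next
    case (step m)
    then obtain t where t: "t \<in> T" "prd E t t \<in> alg_power E m" by blast
    then obtain u where u: "u \<in> T" "coord (prd E t t) u \<noteq> 0" using next_elt by blast
    have "prd E (prd E t t) u \<in> alg_power E (Suc m)"
      using prd_mem_alg_power_Suc step t u assms nonnull_carr by blast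
    then have "scl E (coord (prd E t t) u) (prd E u u) \<in> alg_power E (Suc m)"
      using prd_basis_right t u assms nonnull_B sq_carr by (metis subsetD)
    then have "scl E (inverse (coord (prd E t t) u)) (scl E (coord (prd E t t) u) (prd E u u))
        \<in> alg_power E (Suc m)"
    by (rule alg_power_scl[rotated]) (use step in auto)
    then have "prd E u u \<in> alg_power E (Suc m)" using u(2) by simp
    then show ?case using u(1) by blast
  qed
  then show False using assms unfolding nilpotent_alg_def nonnull_def by blast
qed

end

section \<open>Consequences of condition P\<close>

locale evolution_basis_P = evolution_basis +
  assumes P: "condition_P E"
begin

text \<open>
  Condition \<open>P\<close> for the line through \<open>x\<close>, which is a subalgebra because \<open>x\<^sup>2 = 0\<close>.
\<close>

lemma sq_zero_imp_annihilator:
  assumes x: "x \<in> carr E" "prd E x x = 0"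
  shows "x \<in> annihilator"
proof (cases "x = 0")
  case True
  then show ?thesis using subspace_0[OF subspace_annihilator] by simp
next
  case False
  have "prd E u v \<in> span {x}" if uv: "u \<in> span {x}" "v \<in> span {x}" for u v
  proof -
    obtain p where "u = scl E p x" using uv by (auto simp: span_singleton)
    moreover obtain q where "v = scl E q x" using uv by (auto simp: span_singleton)
    ultimately show ?thesis using x by (simp add: prd_scl_left prd_scl_right carr_scl span_zero)
  qed
  then have sub: "subalgebra (span {x}) E"
    using x(1) span_minimal[OF _ subspace_carr, of "{x}"] subspace_span
    unfolding subalgebra_def by blast
  obtain D C where D: "natural_basis (E\<lparr>carr := span {x}\<rparr>) D" and C: "natural_basis E C" "D \<subseteq> C"
    using P sub unfolding condition_P_def by blast
  interpret C: evolution_basis E C by unfold_locales (rule C)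
  have D': "independent D" "span D = span {x}" using D by (auto simp: natural_basis_def)
  have "D \<noteq> {}" using D' False span_base[of x "{x}"] by auto
  then obtain d where d: "d \<in> D" by blast
  then obtain c where c: "d = scl E c x" using D' span_superset[of D] by (auto simp: span_singleton)
  have c0: "c \<noteq> 0" using c d D' dependent_zero by auto
  have "prd E x y = 0" if y: "y \<in> carr E" for y
  proof -
    have "scl E c (prd E x y) = prd E d y" using c x y by (simp add: prd_scl_left)
    also have "\<dots> = scl E (C.coord y d) (prd E d d)" using C.prd_basis_left y d C by blast
    also have "\<dots> = 0" using c x by (simp add: prd_scl_left prd_scl_right carr_scl)
    finally show ?thesis using c0 by simp
  qed
  then show ?thesis using x by (simp add: annihilator_def)
qed

text \<open>
  Square roots of the coefficients combine to an element whose square is the given combination.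
\<close>

lemma squares_independent:
  assumes "(\<Sum>b\<in>nonnull. scl E (c b) (prd E b b)) = 0" "b \<in> nonnull"
  shows "c b = 0"
proof -
  define x where "x = (\<Sum>b\<in>nonnull. scl E (csqrt (c b)) b)"
  have xc: "x \<in> carr E" unfolding x_def by (rule lincomb_carr[OF nonnull_subset])
  have cx: "coord x b = csqrt (c b)" if "b \<in> nonnull" for b
    unfolding x_def using that nonnull_subset by (subst coord_lincomb) auto
  have "prd E x x = (\<Sum>b\<in>nonnull. scl E (c b) (prd E b b))"
    unfolding prd_expansion_nonnull[OF xc xc]
    by (intro sum.cong) (auto simp: cx power2_eq_square[symmetric])
  then have "x \<in> annihilator" using assms sq_zero_imp_annihilator xc by simp
  then show ?thesis using assms(2) cx by (auto simp: annihilator_iff)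
qed

text \<open>
  The products \<open>x b\<close> and \<open>x b'\<close> both lie on the line through \<open>x\<^sup>2\<close>, but they are nonzero multiples of
  the independent vectors \<open>b\<^sup>2\<close> and \<open>b'\<^sup>2\<close>.
\<close>

lemma natural_one_coord:
  assumes C: "natural_basis E C" and x: "x \<in> C"
    and b: "b \<in> nonnull" "b' \<in> nonnull" "coord x b \<noteq> 0" "coord x b' \<noteq> 0"
  shows "b = b'"
proof (rule ccontr)
  assume ne: "b \<noteq> b'"
  interpret C: evolution_basis E C by unfold_locales (rule C)
  have xc: "x \<in> carr E" using x C.B_carr by blast
  define p q where "p = C.coord b x" and "q = C.coord b' x"
  have p: "scl E (coord x b) (prd E b b) = scl E p (prd E x x)"
    unfolding p_def using C.prd_basis_left[OF x, of b] prd_basis_right[of b x] b xc nonnull_carr nonnull_B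
    by metis
  have q: "scl E (coord x b') (prd E b' b') = scl E q (prd E x x)"
    unfolding q_def using C.prd_basis_left[OF x, of b'] prd_basis_right[of b' x] b xc nonnull_carr nonnull_B
    by metis
  have p0: "p \<noteq> 0" using p b by (auto simp: nonnull_def)
  have q0: "q \<noteq> 0" using q b by (auto simp: nonnull_def)
  have "scl E (q * coord x b) (prd E b b) = scl E (p * q) (prd E x x)"
    using p by (metis mult.commute scale_scale)
  also have "\<dots> = scl E (p * coord x b') (prd E b' b')"
    using q by (metis scale_scale)
  finally have eq: "scl E (q * coord x b) (prd E b b) = scl E (p * coord x b') (prd E b' b')" .
  define c where "c = (\<lambda>u. if u = b then q * coord x b else if u = b' then - (p * coord x b') else 0)"
  have "(\<Sum>u\<in>nonnull. scl E (c u) (prd E u u)) = (\<Sum>u\<in>{b,b'}. scl E (c u) (prd E u u))"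
    using b finite_nonnull by (intro sum.mono_neutral_right) (auto simp: c_def)
  also have "\<dots> = 0" using ne eq by (simp add: c_def)
  finally have "c b = 0" using squares_independent b by blast
  then show False using q0 b by (simp add: c_def)
qed

text \<open>
  Condition \<open>P\<close> for the span of \<open>x\<close> and \<open>x\<^sup>2\<close>, which is a subalgebra because \<open>x\<^sup>2\<close> annihilates
  everything. A basis of this plane has a member outside the annihilator, and that member agrees
  with \<open>x\<close>, up to a nonzero factor, in all coordinates at vectors with nonzero square.
\<close>

lemma sq_annihilator_one_coord:
  assumes x: "x \<in> carr E" "prd E x x \<in> annihilator"
    and b: "b \<in> nonnull" "b' \<in> nonnull" "coord x b \<noteq> 0" "coord x b' \<noteq> 0"
  shows "b = b'"
proof -
  let ?y = "prd E x x"
  have y: "?y \<in> carr E" using x annihilator_carr by blast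
  have xy: "prd E x ?y = 0" "prd E ?y x = 0" "prd E ?y ?y = 0"
    using x y prd_comm[of x ?y] by (auto simp: annihilator_def)
  have x_notin: "x \<notin> annihilator" using b by (auto simp: annihilator_iff)
  have mem: "v \<in> span {x, ?y} \<longleftrightarrow> (\<exists>p q. v = scl E p x + scl E q ?y)" for v
  proof
    assume "v \<in> span {x, ?y}"
    then obtain p where "v - scl E p x \<in> span {?y}" by (auto simp: span_breakdown_eq[of _ x])
    then obtain q where "v - scl E p x = scl E q ?y" by (auto simp: span_singleton)
    then have "v = scl E p x + scl E q ?y" by (simp add: algebra_simps)
    then show "\<exists>p q. v = scl E p x + scl E q ?y" by blast
  qed (auto intro: span_add span_scale span_base)
  have prod: "prd E (scl E p x + scl E q ?y) (scl E p' x + scl E q' ?y) = scl E (p * p') ?y" for p q p' q'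
    using x y xy subspace_add[OF subspace_carr]
    by (simp add: prd_add_left prd_add_right prd_scl_left prd_scl_right carr_scl)
  have "prd E u v \<in> span {x, ?y}" if uv: "u \<in> span {x, ?y}" "v \<in> span {x, ?y}" for u v
  proof -
    obtain p q p' q' where "u = scl E p x + scl E q ?y" "v = scl E p' x + scl E q' ?y"
      using uv mem by metis
    then have "prd E u v = scl E (p * p') ?y" using prod by simp
    moreover have "scl E (p * p') ?y \<in> span {x, ?y}" by (intro span_scale span_base) simp
    ultimately show ?thesis by simp
  qed
  then have sub: "subalgebra (span {x, ?y}) E"
    using x(1) y span_minimal[OF _ subspace_carr, of "{x, ?y}"] subspace_span
    unfolding subalgebra_def by blast
  obtain D C where D: "natural_basis (E\<lparr>carr := span {x, ?y}\<rparr>) D"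
    and C: "natural_basis E C" "D \<subseteq> C"
    using P sub unfolding condition_P_def by blast
  have D': "span D = span {x, ?y}" using D by (auto simp: natural_basis_def)
  \<comment> \<open>A natural basis of the plane inside the annihilator would force \<open>x\<close> into it.\<close>
  have "\<not> D \<subseteq> annihilator"
    using D' span_minimal[OF _ subspace_annihilator, of D] x_notin span_base[of x "{x, ?y}"] by auto
  then obtain d where d: "d \<in> D" "d \<notin> annihilator" by blast
  then obtain p q where pq: "d = scl E p x + scl E q ?y" using mem D' span_superset by blast
  have "p \<noteq> 0" using pq d x subspace_scale[OF subspace_annihilator] by auto
  moreover have "coord d c = p * coord x c" if "c \<in> nonnull" for c
    using that x y unfolding pq annihilator_iff by (simp add: coord_add coord_scl carr_scl)
  ultimately show ?thesis
    using natural_one_coord[OF C(1), of d b b'] d C b by auto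
qed

text \<open>
  As \<open>s\<^sup>2\<close> lies in the annihilator, the coefficient at \<open>s\<close> may be changed to 1. The combination is then
  the square of an element with a nonzero coordinate at \<open>s\<close>, which leaves no room for a second one.
\<close>

lemma squares_independent_mod_annihilator:
  assumes s: "s \<in> nonnull" "prd E s s \<in> annihilator"
    and ann: "(\<Sum>b\<in>nonnull. scl E (c b) (prd E b b)) \<in> annihilator"
    and b: "b \<in> nonnull" "b \<noteq> s"
  shows "c b = 0"
proof -
  define d where "d = (\<lambda>b. if b = s then 1 else csqrt (c b))"
  define x where "x = (\<Sum>b\<in>nonnull. scl E (d b) b)"
  have xc: "x \<in> carr E" unfolding x_def by (rule lincomb_carr[OF nonnull_subset])
  have cx: "coord x b = d b" if "b \<in> nonnull" for b
    unfolding x_def using that nonnull_subset by (subst coord_lincomb) auto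
  have "prd E x x = (\<Sum>b\<in>nonnull. scl E ((d b)\<^sup>2) (prd E b b))"
    unfolding prd_expansion_nonnull[OF xc xc]
    by (intro sum.cong) (auto simp: cx power2_eq_square)
  also have "\<dots> = (\<Sum>b\<in>nonnull. scl E (c b) (prd E b b) + (if b = s then scl E (1 - c s) (prd E s s) else 0))"
    by (intro sum.cong) (auto simp: d_def algebra_simps)
  also have "\<dots> = (\<Sum>b\<in>nonnull. scl E (c b) (prd E b b)) + scl E (1 - c s) (prd E s s)"
    using finite_nonnull s by (simp add: sum.distrib)
  also have "\<dots> \<in> annihilator"
    using s ann subspace_annihilator by (intro subspace_add subspace_scale)
  finally have "prd E x x \<in> annihilator" .
  then show ?thesis
    using sq_annihilator_one_coord[of x b s] xc s b by (auto simp: cx d_def)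
qed

lemma span_squares_Int_annihilator:
  assumes s: "s \<in> nonnull" "prd E s s \<in> annihilator"
    and v: "X \<subseteq> nonnull - {s}" "v \<in> span ((\<lambda>b. prd E b b) ` X)" "v \<in> annihilator"
  shows "v = 0"
proof -
  have fin: "finite X" using v finite_nonnull finite_subset by blast
  then obtain c where c: "v = (\<Sum>b\<in>X. scl E (c b) (prd E b b))"
    using span_image_lincomb v(2) by blast
  also have "\<dots> = (\<Sum>b\<in>nonnull. scl E (if b \<in> X then c b else 0) (prd E b b))"
    using v(1) finite_nonnull by (intro sum.mono_neutral_cong_left) auto
  finally have "(if b \<in> X then c b else 0) = 0" if "b \<in> nonnull" "b \<noteq> s" for b
    using squares_independent_mod_annihilator[OF s, of "\<lambda>b. if b \<in> X then c b else 0" b] v(3) that by simp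
  then have "c b = 0" if "b \<in> X" for b using that v(1) by (metis DiffE insertI1 subsetD)
  then show ?thesis using c by simp
qed

lemma square_notin_span:
  assumes s: "s \<in> nonnull" "prd E s s \<in> annihilator"
    and t: "t \<in> nonnull" "t \<noteq> s" "X \<subseteq> nonnull - {s, t}"
  shows "prd E t t \<notin> span (annihilator \<union> (\<lambda>b. prd E b b) ` X)"
proof
  assume "prd E t t \<in> span (annihilator \<union> (\<lambda>b. prd E b b) ` X)"
  then obtain u v where uv: "prd E t t = u + v" "u \<in> annihilator" "v \<in> span ((\<lambda>b. prd E b b) ` X)"
    unfolding span_Un using span_eq_iff[THEN iffD2, OF subspace_annihilator] by auto
  have fin: "finite X" using t finite_nonnull finite_subset by blast
  then obtain c where c: "v = (\<Sum>b\<in>X. scl E (c b) (prd E b b))"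
    using span_image_lincomb uv(3) by blast
  define d where "d = (\<lambda>b. if b = t then 1 else if b \<in> X then - c b else 0)"
  have tX: "t \<notin> X" using t by auto
  have "(\<Sum>b\<in>nonnull. scl E (d b) (prd E b b)) = (\<Sum>b\<in>insert t X. scl E (d b) (prd E b b))"
    using t finite_nonnull by (intro sum.mono_neutral_right) (auto simp: d_def)
  also have "\<dots> = prd E t t + (\<Sum>b\<in>X. scl E (d b) (prd E b b))"
    using fin tX by (simp add: d_def)
  also have "(\<Sum>b\<in>X. scl E (d b) (prd E b b)) = (\<Sum>b\<in>X. - scl E (c b) (prd E b b))"
    using tX by (intro sum.cong) (auto simp: d_def)
  also have "prd E t t + \<dots> = u" using uv(1) c by (simp add: sum_negf)
  finally have "d t = 0"
    using squares_independent_mod_annihilator[OF s, of d t] uv t by simp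
  then show False by (simp add: d_def)
qed

end

section \<open>The triangular normal form\<close>

locale ordered_evolution_basis = evolution_basis_P +
  fixes s :: "nat \<Rightarrow> 'a" and r :: nat
  assumes bij: "bij_betw s {1..r} nonnull"
    and triangular: "\<lbrakk>i \<in> {1..r}; j \<in> {1..r}; j \<le> i\<rbrakk> \<Longrightarrow> coord (prd E (s i) (s i)) (s j) = 0"
begin

lemma s_nonnull: "i \<in> {1..r} \<Longrightarrow> s i \<in> nonnull"
  using bij bij_betwE by blast

lemma s_inj: "i \<in> {1..r} \<Longrightarrow> j \<in> {1..r} \<Longrightarrow> s i = s j \<longleftrightarrow> i = j"
  using inj_on_eq_iff[OF bij_betw_imp_inj_on[OF bij]] by blast

lemma s_carr: "i \<in> {1..r} \<Longrightarrow> s i \<in> carr E"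
  using s_nonnull nonnull_carr by blast

lemma square_mod_annihilator:
  assumes i: "i \<in> {1..r}"
  shows "prd E (s i) (s i) - (\<Sum>j=Suc i..r. scl E (coord (prd E (s i) (s i)) (s j)) (s j))
    \<in> annihilator"
proof -
  let ?c = "coord (prd E (s i) (s i))"
  have "(\<Sum>b\<in>nonnull. scl E (?c b) b) = (\<Sum>j\<in>{1..r}. scl E (?c (s j)) (s j))"
    using sum.reindex_bij_betw[OF bij, of "\<lambda>b. scl E (?c b) b"] by simp
  also have "\<dots> = (\<Sum>j=Suc i..r. scl E (?c (s j)) (s j))"
    using i triangular by (intro sum.mono_neutral_right) auto
  finally show ?thesis
    using diff_nonnull_part_annihilator[of "prd E (s i) (s i)"] s_nonnull[OF i] sq_carr by simp
qed

lemma last_square_annihilator: "r \<ge> 1 \<Longrightarrow> prd E (s r) (s r) \<in> annihilator"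
  using square_mod_annihilator[of r] by simp

text \<open>
  The vectors \<open>s\<^sub>m\<^sup>2, \<dots>, s\<^sub>r\<^sub>-\<^sub>1\<^sup>2\<close> are independent modulo the annihilator \<open>A\<close> and lie in
  \<open>A + \<langle>s\<^sub>m\<^sub>+\<^sub>1, \<dots>, s\<^sub>r\<rangle>\<close>, so by dimension they generate this space together with \<open>A\<close>. Going down from
  \<open>m = r\<close> replaces the dimension count: once the claim holds for \<open>m + 1\<close>, a zero coefficient of \<open>s\<^sub>m\<^sup>2\<close> at
  \<open>s\<^sub>m\<^sub>+\<^sub>1\<close> would make \<open>s\<^sub>m\<^sup>2\<close> depend on the later squares modulo \<open>A\<close>, and a nonzero one allows solving
  for \<open>s\<^sub>m\<^sub>+\<^sub>1\<close>. The two conclusions are thus proved together.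
\<close>

lemma flag_in_span_squares:
  assumes "m \<le> r" "1 \<le> m"
  shows "(\<forall>j\<in>{Suc m..r}. s j \<in> span (annihilator \<union> (\<lambda>b. prd E b b) ` s ` {m..<r})) \<and>
    (m < r \<longrightarrow> coord (prd E (s m) (s m)) (s (Suc m)) \<noteq> 0)"
  using assms
proof (induction m rule: inc_induct)
  case base
  then show ?case by simp
next
  case (step m)
  let ?sq = "\<lambda>b. prd E b b" and ?c = "\<lambda>j. coord (prd E (s m) (s m)) (s j)"
  let ?V = "\<lambda>m. span (annihilator \<union> (\<lambda>b. prd E b b) ` s ` {m..<r})"
  have mono: "?V (Suc m) \<subseteq> ?V m" by (intro span_mono) auto
  have IH: "s j \<in> ?V (Suc m)" if "j \<in> {Suc (Suc m)..r}" for j using step that by auto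
  define u where "u = ?sq (s m) - (\<Sum>j=Suc m..r. scl E (?c j) (s j))"
  have u: "u \<in> ?V (Suc m)"
    unfolding u_def using square_mod_annihilator[of m] step by (intro span_base) auto
  have split: "(\<Sum>j=Suc m..r. scl E (?c j) (s j))
      = scl E (?c (Suc m)) (s (Suc m)) + (\<Sum>j=Suc (Suc m)..r. scl E (?c j) (s j))"
    using step by (intro sum.atLeast_Suc_atMost) auto
  have tail: "(\<Sum>j=Suc (Suc m)..r. scl E (?c j) (s j)) \<in> ?V (Suc m)"
    using IH by (intro span_sum span_scale) auto
  have notin: "?sq (s m) \<notin> ?V (Suc m)"
  proof (rule square_notin_span[of "s r"])
    show "s r \<in> nonnull" "s m \<in> nonnull" "s m \<noteq> s r" using s_nonnull s_inj step by auto
    show "?sq (s r) \<in> annihilator" using last_square_annihilator step by simp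
    show "s ` {Suc m..<r} \<subseteq> nonnull - {s r, s m}" using s_nonnull s_inj step by auto
  qed
  have eq: "?sq (s m) = u + (scl E (?c (Suc m)) (s (Suc m))
      + (\<Sum>j=Suc (Suc m)..r. scl E (?c j) (s j)))"
    unfolding u_def split by simp
  have c: "?c (Suc m) \<noteq> 0"
  proof
    assume "?c (Suc m) = 0"
    then have "?sq (s m) = u + (\<Sum>j=Suc (Suc m)..r. scl E (?c j) (s j))" using eq by simp
    then show False using notin span_add[OF u tail] by simp
  qed
  have "scl E (?c (Suc m)) (s (Suc m)) = ?sq (s m) - (u + (\<Sum>j=Suc (Suc m)..r. scl E (?c j) (s j)))"
    using eq by (simp add: algebra_simps)
  also have "\<dots> \<in> ?V m"
  proof (rule span_diff)
    show "?sq (s m) \<in> ?V m" using step by (intro span_base) auto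
    show "u + (\<Sum>j=Suc (Suc m)..r. scl E (?c j) (s j)) \<in> ?V m"
      using span_add[OF u tail] mono by blast
  qed
  finally have "scl E (inverse (?c (Suc m))) (scl E (?c (Suc m)) (s (Suc m))) \<in> ?V m"
    by (rule span_scale)
  then have "s (Suc m) \<in> ?V m" using c by simp
  moreover have "s j \<in> ?V m" if "j \<in> {Suc (Suc m)..r}" for j using IH[OF that] mono by blast
  ultimately have "s j \<in> ?V m" if "j \<in> {Suc m..r}" for j
    using that by (cases "j = Suc m") auto
  then show ?case using c by blast
qed

lemma superdiagonal_nonzero:
  "1 \<le> m \<Longrightarrow> m < r \<Longrightarrow> coord (prd E (s m) (s m)) (s (Suc m)) \<noteq> 0"
  using flag_in_span_squares[of m] by simp

lemma ex_component_in_squares: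
  assumes "j \<in> {2..r}"
  shows "\<exists>p. p \<in> span ((\<lambda>b. prd E b b) ` s ` {1..<r}) \<and> s j - p \<in> annihilator"
proof -
  have "s j \<in> span (annihilator \<union> (\<lambda>b. prd E b b) ` s ` {1..<r})" using flag_in_span_squares[of 1] assms by auto
  then obtain u v where "s j = u + v" "u \<in> annihilator" "v \<in> span ((\<lambda>b. prd E b b) ` s ` {1..<r})"
    unfolding span_Un using span_eq_iff[THEN iffD2, OF subspace_annihilator] by auto
  then show ?thesis by (intro exI[of _ v]) simp
qed

text \<open>
  All of the normal form except that the superdiagonal entries are only nonzero; the basis vectors
  beyond the first \<open>k\<close> span the summand with zero product.
\<close>

lemma ex_structure_matrix_superdiagonal:
  assumes n: "dim (carr E) = n" "n \<ge> 1"
  shows "\<exists>k f a. 1 \<le> k \<and> k \<le> n \<and> structure_matrix E n f a \<and>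
    (\<forall>i\<in>{1..n}. \<forall>j\<in>{1..n}. k \<le> i \<or> k < j \<or> j \<le> i \<longrightarrow> a i j = 0) \<and>
    (\<forall>i. 1 \<le> i \<and> i + 1 \<le> k \<longrightarrow> a i (i + 1) \<noteq> 0) \<and>
    (\<forall>i. 1 \<le> i \<and> i + 2 \<le> k \<longrightarrow> a i k = 0)"
proof -
  let ?sq = "\<lambda>b. prd E b b"
  define Q where "Q = span (?sq ` s ` {1..<r})"
  define k where "k = Suc r"
  have "\<forall>j\<in>{2..r}. \<exists>p. p \<in> Q \<and> s j - p \<in> annihilator"
    unfolding Q_def using ex_component_in_squares by blast
  then obtain p where p: "\<And>j. j \<in> {2..r} \<Longrightarrow> p j \<in> Q" "\<And>j. j \<in> {2..r} \<Longrightarrow> s j - p j \<in> annihilator"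
    by metis
  \<comment> \<open>The vector \<open>s\<^sub>1\<close> need not lie in \<open>A + Q\<close>. It can be kept because it has coefficient 0 in every
    square.\<close>
  define f\<^sub>0 where "f\<^sub>0 = (\<lambda>j. if j = 1 then s 1 else p j)"
  have f0_mod: "s j - f\<^sub>0 j \<in> annihilator" if "j \<in> {1..r}" for j
    using that p(2)[of j] subspace_0[OF subspace_annihilator] by (auto simp: f\<^sub>0_def)
  have f0_Q: "f\<^sub>0 j \<in> Q" if "j \<in> {2..r}" for j
    using that p(1)[of j] by (auto simp: f\<^sub>0_def)
  have f0_carr: "f\<^sub>0 j \<in> carr E" if "j \<in> {1..r}" for j
    using subspace_diff[OF subspace_carr s_carr[OF that] annihilator_carr[OF f0_mod[OF that]]] by simp
  have cardB: "card B = n"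
    using dim_eq_card[of B "carr E"] independent_B span_B n(1) span_span[of B] by metis
  have card_nonnull: "card nonnull = r" using bij_betw_same_card[OF bij] by simp
  \<comment> \<open>The last vector of the chain is \<open>s\<^sub>r\<^sup>2\<close>. If all products vanish there is no such square, and any
    nonzero vector of the annihilator serves as a chain of length 1.\<close>
  obtain z where z: "z \<in> annihilator" "z \<noteq> 0" "r \<ge> 1 \<Longrightarrow> z = ?sq (s r)"
  proof (cases "r = 0")
    case True
    then have "nonnull = {}" using card_nonnull finite_nonnull by simp
    moreover obtain b where "b \<in> B" using cardB n(2) by fastforce
    moreover have "b \<noteq> 0" using \<open>b \<in> B\<close> independent_B dependent_zero by metis
    ultimately show ?thesis
      using that[of b] True B_carr by (simp add: annihilator_iff)
  next
    case False
    then show ?thesis using that[of "?sq (s r)"] last_square_annihilator s_nonnull[of r] by (auto simp: nonnull_def)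
  qed
  obtain H where H: "{z} \<subseteq> H" "H \<subseteq> annihilator" "independent H" "annihilator \<subseteq> span H"
    using maximal_independent_subset_extend[of "{z}" annihilator] z by (auto simp: dependent_single)
  have spanH: "span H = annihilator"
    using H span_minimal[OF _ subspace_annihilator] by blast
  have "card H = card (B - nonnull)"
  proof -
    have "dim annihilator = card H"
      using dim_eq_card[of H annihilator] H spanH span_span[of H] by metis
    moreover have "dim annihilator = card (B - nonnull)"
      using dim_eq_card[of "B - nonnull" annihilator] annihilator_span span_span[of "B - nonnull"]
        independent_mono[OF independent_B, of "B - nonnull"] by auto
    ultimately show ?thesis by simp
  qed
  also have "\<dots> = n - r" using cardB card_nonnull card_Diff_subset[OF finite_nonnull nonnull_subset] by simp
  finally have cardH: "card H = n - r" .
  have finH: "finite H" using finite_independent_carr H annihilator_carr by blast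
  have "card H \<ge> 1" using finH H(1) by (metis One_nat_def Suc_leI card_gt_0_iff empty_iff insert_subset)
  then have kn: "k \<le> n" using cardH by (simp add: k_def)
  have "card (H - {z}) = card {Suc k..n}"
    using finH H(1) cardH by (simp add: k_def)
  then obtain h where h: "bij_betw h {Suc k..n} (H - {z})"
    using finite_same_card_bij[of "{Suc k..n}" "H - {z}"] finH by auto
  define f where "f = (\<lambda>j. if j \<le> r then f\<^sub>0 j else if j = k then z else h j)"
  have f_low: "f j = f\<^sub>0 j" if "j \<in> {1..r}" for j using that by (simp add: f_def)
  have f_k: "f k = z" by (simp add: f_def k_def)
  have f_ann: "f j \<in> annihilator" if "j \<in> {1..n}" "r < j" for j
  proof (cases "j = k")
    case False
    then have "h j \<in> H" using h that by (auto simp: bij_betw_def k_def)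
    then show ?thesis using that False H by (auto simp: f_def)
  qed (use f_k z in auto)
  have f_carr: "f j \<in> carr E" if "j \<in> {1..n}" for j
    using that f_low[of j] f0_carr[of j] f_ann[of j] annihilator_carr by (cases "j \<le> r") auto
  have prd_ann: "prd E x y = 0" if "x \<in> annihilator \<or> y \<in> annihilator" "x \<in> carr E" "y \<in> carr E" for x y
    using that prd_comm[of x y] by (auto simp: annihilator_def)
  have prd_f: "prd E (f i) (f j) = prd E (s i) (s j)" if "i \<in> {1..r}" "j \<in> {1..r}" for i j
  proof -
    have "prd E (s i) (s j) = prd E (f\<^sub>0 i + (s i - f\<^sub>0 i)) (f\<^sub>0 j + (s j - f\<^sub>0 j))" by simp
    also have "\<dots> = prd E (f\<^sub>0 i) (f\<^sub>0 j + (s j - f\<^sub>0 j)) + prd E (s i - f\<^sub>0 i) (f\<^sub>0 j + (s j - f\<^sub>0 j))"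
      using that f0_carr annihilator_carr[OF f0_mod] s_carr by (intro prd_add_left) auto
    also have "prd E (s i - f\<^sub>0 i) (f\<^sub>0 j + (s j - f\<^sub>0 j)) = 0"
      using that annihilator_carr[OF f0_mod] f0_mod s_carr by (intro prd_ann) auto
    also have "prd E (f\<^sub>0 i) (f\<^sub>0 j + (s j - f\<^sub>0 j)) = prd E (f\<^sub>0 i) (f\<^sub>0 j) + prd E (f\<^sub>0 i) (s j - f\<^sub>0 j)"
      using that f0_carr annihilator_carr[OF f0_mod] by (intro prd_add_right) auto
    also have "prd E (f\<^sub>0 i) (s j - f\<^sub>0 j) = 0"
      using that annihilator_carr[OF f0_mod] f0_mod f0_carr by (intro prd_ann) auto
    finally show ?thesis using that f_low by simp
  qed
  define a where "a = (\<lambda>i j. if i < r \<and> j \<le> r then coord (?sq (s i)) (s j)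
    else if i = r \<and> j = k then 1 else 0)"
  have struct: "structure_matrix E n f a"
  proof (rule structure_matrixI[OF _ n(1)])
    show "span (f ` {1..n}) = carr E"
    proof
      show "span (f ` {1..n}) \<subseteq> carr E"
        using f_carr by (intro span_minimal subspace_carr) auto
      have "H \<subseteq> f ` {1..n}"
      proof
        fix x assume "x \<in> H"
        show "x \<in> f ` {1..n}"
        proof (cases "x = z")
          case True
          then show ?thesis using f_k kn k_def by auto
        next
          case False
          then have "x \<in> h ` {Suc k..n}" using h \<open>x \<in> H\<close> by (auto simp: bij_betw_def)
          then obtain j where "j \<in> {Suc k..n}" "x = h j" by blast
          then show ?thesis by (intro image_eqI[of _ _ j]) (auto simp: f_def k_def)
        qed
      qed
      then have ann: "annihilator \<subseteq> span (f ` {1..n})" using spanH span_mono by metis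
      have "b \<in> span (f ` {1..n})" if "b \<in> B" for b
      proof (cases "b \<in> nonnull")
        case True
        then obtain j where j: "j \<in> {1..r}" "b = s j"
          using True bij_betw_imp_surj_on[OF bij] by blast
        have "b = f j + (s j - f\<^sub>0 j)" using j f_low by simp
        moreover have "f j \<in> span (f ` {1..n})" using j kn k_def by (intro span_base) auto
        ultimately show ?thesis using ann f0_mod[OF j(1)] span_add by (metis subsetD)
      next
        case False
        then have "b \<in> annihilator" unfolding annihilator_span using that by (intro span_base) simp
        then show ?thesis using ann by blast
      qed
      then show "carr E \<subseteq> span (f ` {1..n})"
        unfolding span_B[symmetric] by (intro span_minimal subspace_span subsetI)
    qed
  next
    fix i j assume ij: "i \<in> {1..n}" "j \<in> {1..n}" "i \<noteq> j"
    show "prd E (f i) (f j) = 0"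
    proof (cases "i \<le> r \<and> j \<le> r")
      case True
      then have "prd E (f i) (f j) = prd E (s i) (s j)" using prd_f ij by simp
      moreover have "s i \<noteq> s j" using s_inj True ij by simp
      moreover have "s i \<in> B" "s j \<in> B" using s_nonnull nonnull_B True ij by auto
      ultimately show ?thesis using orth by simp
    next
      case False
      then have "f i \<in> annihilator \<or> f j \<in> annihilator" using f_ann ij by auto
      then show ?thesis using prd_ann f_carr ij by blast
    qed
  next
    fix i assume i: "i \<in> {1..n}"
    consider "i < r" | "i = r" | "r < i" by linarith
    then show "prd E (f i) (f i) = (\<Sum>j=1..n. scl E (a i j) (f j))"
    proof cases
      case 1
      let ?c = "\<lambda>j. coord (?sq (s i)) (s j)"
      have ir: "i \<in> {1..r}" using i 1 by simp
      \<comment> \<open>The matrix entries are unchanged: the difference of both sides lies in \<open>Q\<close> since all vectors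
        involved do, and in the annihilator since the equation holds there for the \<open>s\<^sub>j\<close>.\<close>
      have "(\<Sum>j=1..n. scl E (a i j) (f j)) = (\<Sum>j=Suc i..r. scl E (?c j) (f\<^sub>0 j))"
        using 1 i kn triangular[OF ir] f_low
        by (intro sum.mono_neutral_cong_right) (auto simp: a_def k_def)
      moreover have "?sq (s i) - (\<Sum>j=Suc i..r. scl E (?c j) (f\<^sub>0 j)) = 0"
      proof (rule span_squares_Int_annihilator[of "s r" "s ` {1..<r}"])
        show "s r \<in> nonnull" "?sq (s r) \<in> annihilator" using s_nonnull 1 last_square_annihilator by auto
        show "s ` {1..<r} \<subseteq> nonnull - {s r}" using s_nonnull s_inj by auto
        have "?sq (s i) \<in> Q" unfolding Q_def using ir 1 by (intro span_base) auto
        moreover have "(\<Sum>j=Suc i..r. scl E (?c j) (f\<^sub>0 j)) \<in> Q"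
          using f0_Q ir unfolding Q_def by (intro span_sum span_scale) auto
        ultimately show "?sq (s i) - (\<Sum>j=Suc i..r. scl E (?c j) (f\<^sub>0 j)) \<in> span (?sq ` s ` {1..<r})"
          unfolding Q_def by (rule span_diff)
        have "?sq (s i) - (\<Sum>j=Suc i..r. scl E (?c j) (s j)) \<in> annihilator"
          using square_mod_annihilator ir by blast
        moreover have "(\<Sum>j=Suc i..r. scl E (?c j) (s j - f\<^sub>0 j)) \<in> annihilator"
          using f0_mod ir subspace_annihilator by (intro subspace_sum subspace_scale) auto
        ultimately have "?sq (s i) - (\<Sum>j=Suc i..r. scl E (?c j) (s j))
            + (\<Sum>j=Suc i..r. scl E (?c j) (s j - f\<^sub>0 j)) \<in> annihilator"
          using subspace_add[OF subspace_annihilator] by blast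
        then show "?sq (s i) - (\<Sum>j=Suc i..r. scl E (?c j) (f\<^sub>0 j)) \<in> annihilator"
          by (simp add: scale_right_diff_distrib sum_subtractf)
      qed
      ultimately show ?thesis using prd_f[OF ir ir] by simp
    next
      case 2
      have "(\<Sum>j=1..n. scl E (a i j) (f j)) = (\<Sum>j\<in>{k}. scl E (a i j) (f j))"
        using 2 kn by (intro sum.mono_neutral_right) (auto simp: a_def k_def)
      also have "\<dots> = z" using 2 f_k by (simp add: a_def k_def)
      finally show ?thesis using 2 i z(3) prd_f[of r r] by simp
    next
      case 3
      then show ?thesis using f_ann[OF i 3] prd_ann f_carr[OF i] by (simp add: a_def)
    qed
  qed
  have "a i j = 0" if "i \<in> {1..n}" "j \<in> {1..n}" "k \<le> i \<or> k < j \<or> j \<le> i" for i j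
    using that triangular[of i j] by (auto simp: a_def k_def)
  moreover have "a i (i + 1) \<noteq> 0" if "1 \<le> i \<and> i + 1 \<le> k" for i
    using that superdiagonal_nonzero[of i] by (cases "i = r") (auto simp: a_def k_def)
  moreover have "a i k = 0" if "1 \<le> i \<and> i + 2 \<le> k" for i
    using that by (simp add: a_def k_def)
  ultimately show ?thesis using struct kn by (intro exI[of _ k] exI[of _ f] exI[of _ a]) (auto simp: k_def)
qed

end

section \<open>The rescaling and the model algebra\<close>

text \<open>
  Scaling the basis vectors by \<open>l\<close> turns \<open>a\<^sub>i\<^sub>j\<close> into \<open>l\<^sub>i\<^sup>2 a\<^sub>i\<^sub>j / l\<^sub>j\<close>, so this recursion is the condition that
  the superdiagonal entries \<open>d\<^sub>i = a\<^sub>i\<^sub>,\<^sub>i\<^sub>+\<^sub>1\<close> become 1.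
\<close>

lemma ex_diagonal_scaling:
  fixes d :: "nat \<Rightarrow> complex"
  assumes "\<And>i. 1 \<le> i \<Longrightarrow> i < k \<Longrightarrow> d i \<noteq> 0"
  shows "\<exists>l. (\<forall>i. l i \<noteq> 0) \<and> (\<forall>i. 1 \<le> i \<and> i < k \<longrightarrow> l (Suc i) = (l i)\<^sup>2 * d i)"
proof -
  define l :: "nat \<Rightarrow> complex" where
    "l = rec_nat 1 (\<lambda>i x. if 1 \<le> i \<and> i < k then x\<^sup>2 * d i else 1)"
  have "l i \<noteq> 0" for i by (induction i) (use assms in \<open>auto simp: l_def\<close>)
  moreover have "l (Suc i) = (l i)\<^sup>2 * d i" if "1 \<le> i \<and> i < k" for i
    using that by (simp add: l_def)
  ultimately show ?thesis by blast
qed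

text \<open>
  The basis is indexed by \<open>{1..k}\<close>, as in the structure matrices, so tuples are functions vanishing
  outside this set.
\<close>

definition matrix_alg :: "nat \<Rightarrow> (nat \<Rightarrow> nat \<Rightarrow> complex) \<Rightarrow> (nat \<Rightarrow> complex) calg" where
  "matrix_alg k a = \<lparr>carr = {v. \<forall>i. i \<notin> {1..k} \<longrightarrow> v i = 0}, scl = (\<lambda>c v i. c * v i),
     prd = (\<lambda>v w j. if j \<in> {1..k} then \<Sum>i=1..k. v i * w i * a i j else 0)\<rparr>"

definition unit_vec :: "nat \<Rightarrow> nat \<Rightarrow> complex" where
  "unit_vec i = (\<lambda>j. if j = i then 1 else 0)"

lemma inj_unit_vec: "inj unit_vec"
  by (auto simp: inj_def unit_vec_def fun_eq_iff split: if_splits)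

lemma sum_function_apply: "(\<Sum>i\<in>I. f i) x = (\<Sum>i\<in>I. f i x)"
  for f :: "'i \<Rightarrow> 'b \<Rightarrow> 'c::comm_monoid_add"
  by (induction I rule: infinite_finite_induct) auto

lemma unit_vec_expansion:
  assumes "\<forall>i. i \<notin> {1..k} \<longrightarrow> v i = 0"
  shows "v = (\<Sum>i=1..k. (\<lambda>j. v i * unit_vec i j))"
proof
  fix j
  have "(\<Sum>i=1..k. v i * unit_vec i j) = (\<Sum>i=1..k. if j = i then v i else 0)"
    by (intro sum.cong) (auto simp: unit_vec_def)
  also have "\<dots> = v j" using assms by auto
  finally show "v j = (\<Sum>i=1..k. (\<lambda>j. v i * unit_vec i j)) j" by (simp add: sum_function_apply)
qed

lemma matrix_alg_evolution:
  shows "evolution_algebra (matrix_alg k a)" and "structure_matrix (matrix_alg k a) k unit_vec a"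
proof -
  let ?F = "matrix_alg k a"
  interpret vector_space "scl ?F"
    by unfold_locales (auto simp: matrix_alg_def algebra_simps)
  have sub: "subspace (carr ?F)" unfolding subspace_def by (auto simp: matrix_alg_def)
  have span: "span (unit_vec ` {1..k}) = carr ?F"
  proof
    show "span (unit_vec ` {1..k}) \<subseteq> carr ?F"
      by (intro span_minimal sub) (auto simp: matrix_alg_def unit_vec_def)
    show "carr ?F \<subseteq> span (unit_vec ` {1..k})"
    proof
      fix v assume "v \<in> carr ?F"
      then have "v = (\<Sum>i=1..k. scl ?F (v i) (unit_vec i))"
        using unit_vec_expansion[of k v] by (simp add: matrix_alg_def)
      then show "v \<in> span (unit_vec ` {1..k})"
        by (metis (no_types, lifting) imageI span_base span_scale span_sum)
    qed
  qed
  have alg: "complex_algebra ?F"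
  proof unfold_locales
    show "\<exists>B. finite B \<and> span B = carr ?F" using span by blast
  qed (use sub in \<open>auto simp: matrix_alg_def fun_eq_iff algebra_simps sum.distrib sum_distrib_left\<close>)
  have "independent (unit_vec ` {1..k})"
  proof (rule independent_if_scalars_zero)
    fix c x assume eq: "(\<Sum>x\<in>unit_vec ` {1..k}. scl ?F (c x) x) = 0" and "x \<in> unit_vec ` {1..k}"
    then obtain j where j: "j \<in> {1..k}" "x = unit_vec j" by blast
    have "0 = (\<Sum>i=1..k. scl ?F (c (unit_vec i)) (unit_vec i)) j"
      using eq by (subst (asm) sum.reindex) (auto intro: inj_on_subset[OF inj_unit_vec])
    also have "\<dots> = (\<Sum>i=1..k. if j = i then c (unit_vec i) else 0)"
      unfolding sum_function_apply by (intro sum.cong) (auto simp: matrix_alg_def unit_vec_def)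
    finally show "c x = 0" using j by simp
  qed simp
  moreover have "prd ?F x y = 0"
    if xy: "x \<in> unit_vec ` {1..k}" "y \<in> unit_vec ` {1..k}" "x \<noteq> y" for x y
    using xy by (auto simp: matrix_alg_def unit_vec_def fun_eq_iff intro!: sum.neutral)
  ultimately have nat: "natural_basis ?F (unit_vec ` {1..k})"
    using span by (auto simp: natural_basis_def)
  then show "evolution_algebra ?F" using alg by (auto simp: evolution_algebra_def)
  have "prd ?F (unit_vec i) (unit_vec i) = (\<Sum>j=1..k. scl ?F (a i j) (unit_vec j))" if "i \<in> {1..k}" for i
  proof
    fix j
    have "(\<Sum>m=1..k. unit_vec i m * unit_vec i m * a m j) = (\<Sum>m=1..k. if i = m then a m j else 0)"
      by (intro sum.cong) (auto simp: unit_vec_def)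
    also have "\<dots> = a i j" using that by simp
    finally have "prd ?F (unit_vec i) (unit_vec i) j = (if j \<in> {1..k} then a i j else 0)"
      by (simp add: matrix_alg_def)
    also have "\<dots> = (\<Sum>m=1..k. if j = m then a i m else 0)" by simp
    also have "\<dots> = (\<Sum>m=1..k. scl ?F (a i m) (unit_vec m)) j"
      unfolding sum_function_apply by (intro sum.cong) (auto simp: matrix_alg_def unit_vec_def)
    finally show "prd ?F (unit_vec i) (unit_vec i) j = (\<Sum>j=1..k. scl ?F (a i j) (unit_vec j)) j" .
  qed
  then show "structure_matrix ?F k unit_vec a"
    unfolding structure_matrix_def using nat inj_on_subset[OF inj_unit_vec] by blast
qed

text \<open>
  The coordinate map is the isomorphism: the first \<open>k\<close> coordinates multiply by the matrix alone, and
  the remaining ones vanish on all products.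
\<close>

lemma (in complex_algebra) structure_matrix_iso:
  assumes g: "structure_matrix E n g a" and kn: "k \<le> n"
    and zero: "\<And>i j. i \<in> {1..n} \<Longrightarrow> j \<in> {1..n} \<Longrightarrow> k < i \<or> k < j \<Longrightarrow> a i j = 0"
  shows "E \<cong>\<^sub>a (matrix_alg k a \<oplus>\<^sub>a null_alg (n - k))"
proof -
  have inj: "inj_on g {1..n}" and nat: "natural_basis E (g ` {1..n})"
    and sq: "\<And>i. i \<in> {1..n} \<Longrightarrow> prd E (g i) (g i) = (\<Sum>j=1..n. scl E (a i j) (g j))"
    using g unfolding structure_matrix_def by blast+
  interpret evolution_basis E "g ` {1..n}" by unfold_locales (rule nat)
  let ?G = "g ` {1..n}"
  define c where "c = (\<lambda>x i. coord x (g i))"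
  have c_lincomb: "c (\<Sum>i=1..n. scl E (d i) (g i)) i = d i" if "i \<in> {1..n}" for d i
  proof -
    have "(\<Sum>i=1..n. scl E (d i) (g i)) = (\<Sum>b\<in>?G. scl E (d (the_inv_into {1..n} g b)) b)"
      using inj by (subst sum.reindex) (auto simp: the_inv_into_f_f intro!: sum.cong)
    then have "c (\<Sum>i=1..n. scl E (d i) (g i)) i = d (the_inv_into {1..n} g (g i))"
      using that coord_lincomb[of ?G "g i"] by (simp add: c_def)
    then show ?thesis using that inj by (simp add: the_inv_into_f_f)
  qed
  have c_add: "c (x + y) i = c x i + c y i" if "x \<in> carr E" "y \<in> carr E" for x y i
    unfolding c_def using coord_add that .
  have c_scl: "c (scl E t x) i = t * c x i" if "x \<in> carr E" for t x i
    unfolding c_def using coord_scl that .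
  have c_expansion: "(\<Sum>i=1..n. scl E (c x i) (g i)) = x" if "x \<in> carr E" for x
    using coord_expansion[OF that] unfolding sum.reindex[OF inj] by (simp add: c_def)
  have g_carr: "g i \<in> carr E" if "i \<in> {1..n}" for i using B_carr that by blast
  have c_prd: "c (prd E x y) j = (\<Sum>i=1..n. c x i * c y i * a i j)"
    if "x \<in> carr E" "y \<in> carr E" "j \<in> {1..n}" for x y j
  proof -
    have "prd E x y = (\<Sum>i=1..n. scl E (c x i * c y i) (prd E (g i) (g i)))"
      unfolding prd_expansion[OF that(1,2)] sum.reindex[OF inj] by (simp add: c_def)
    then have "c (prd E x y) j = c (\<Sum>i=1..n. scl E (c x i * c y i) (prd E (g i) (g i))) j"
      by (rule arg_cong)
    also have "\<dots> = (\<Sum>i=1..n. c (scl E (c x i * c y i) (prd E (g i) (g i))) j)"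
      unfolding c_def using g_carr by (intro coord_sum carr_scl prd_closed)
    also have "\<dots> = (\<Sum>i=1..n. c x i * c y i * c (prd E (g i) (g i)) j)"
      using g_carr by (intro sum.cong refl c_scl prd_closed)
    also have "\<dots> = (\<Sum>i=1..n. c x i * c y i * a i j)"
      using sq c_lincomb that by (intro sum.cong) auto
    finally show ?thesis .
  qed
  define F where "F = matrix_alg k a \<oplus>\<^sub>a null_alg (n - k)"
  define \<phi> where "\<phi> = (\<lambda>x. (\<lambda>i. if i \<in> {1..k} then c x i else 0,
    \<lambda>i. if i < n - k then c x (Suc (k + i)) else 0))"
  have "inj_on \<phi> (carr E)"
  proof
    fix x y assume xy: "x \<in> carr E" "y \<in> carr E" "\<phi> x = \<phi> y"
    then have components: "fst (\<phi> x) i = fst (\<phi> y) i" "snd (\<phi> x) i = snd (\<phi> y) i" for i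
      by simp_all
    have "c x i = c y i" if "i \<in> {1..n}" for i
    proof (cases "i \<le> k")
      case True
      then show ?thesis using that components(1)[of i] by (simp add: \<phi>_def)
    next
      case False
      then have "i - Suc k < n - k" "Suc (k + (i - Suc k)) = i" using that by auto
      then show ?thesis using components(2)[of "i - Suc k"] by (simp add: \<phi>_def)
    qed
    then have "(\<Sum>i=1..n. scl E (c x i) (g i)) = (\<Sum>i=1..n. scl E (c y i) (g i))"
      by (intro sum.cong) auto
    then show "x = y" using c_expansion xy by simp
  qed
  moreover have "\<phi> ` carr E = carr F"
  proof
    show "\<phi> ` carr E \<subseteq> carr F"
      by (auto simp: \<phi>_def F_def direct_sum_def matrix_alg_def null_alg_def)
    show "carr F \<subseteq> \<phi> ` carr E"
    proof
      fix p assume "p \<in> carr F"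
      then obtain v w where p: "p = (v, w)" "\<And>i. i \<notin> {1..k} \<Longrightarrow> v i = 0" "\<And>i. i \<ge> n - k \<Longrightarrow> w i = 0"
        by (auto simp: F_def direct_sum_def matrix_alg_def null_alg_def)
      define d where "d = (\<lambda>i. if i \<le> k then v i else w (i - Suc k))"
      define x where "x = (\<Sum>i=1..n. scl E (d i) (g i))"
      have "x \<in> carr E" unfolding x_def
        using g_carr by (intro subspace_sum[OF subspace_carr] carr_scl) auto
      moreover have "\<phi> x = p"
      proof -
        have cx: "c x i = d i" if "i \<in> {1..n}" for i
          unfolding x_def using c_lincomb[OF that] .
        have "(\<lambda>i. if i \<in> {1..k} then c x i else 0) = v"
          using kn p(2) by (auto simp: cx d_def)
        moreover have "(\<lambda>i. if i < n - k then c x (Suc (k + i)) else 0) = w"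
          using kn p(3) by (auto simp: cx d_def)
        ultimately show ?thesis by (simp only: \<phi>_def p(1))
      qed
      ultimately show "p \<in> \<phi> ` carr E" by blast
    qed
  qed
  ultimately have "bij_betw \<phi> (carr E) (carr F)" by (simp add: bij_betw_def)
  moreover have "\<phi> (x + y) = \<phi> x + \<phi> y" if "x \<in> carr E" "y \<in> carr E" for x y
    using that by (auto simp: \<phi>_def c_add fun_eq_iff)
  moreover have "\<phi> (scl E t x) = scl F t (\<phi> x)" if "x \<in> carr E" for t x
    using that
    by (auto simp: \<phi>_def c_scl fun_eq_iff F_def direct_sum_def matrix_alg_def null_alg_def)
  moreover have "\<phi> (prd E x y) = prd F (\<phi> x) (\<phi> y)" if xy: "x \<in> carr E" "y \<in> carr E" for x y
  proof -
    have low: "c (prd E x y) j = (\<Sum>i=1..k. c x i * c y i * a i j)" if "j \<in> {1..k}" for j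
    proof -
      have "c (prd E x y) j = (\<Sum>i=1..n. c x i * c y i * a i j)" using c_prd xy that kn by simp
      also have "\<dots> = (\<Sum>i=1..k. c x i * c y i * a i j)"
        using kn zero that by (intro sum.mono_neutral_right) auto
      finally show ?thesis .
    qed
    have high: "c (prd E x y) (Suc (k + j)) = 0" if "j < n - k" for j
      using that xy by (subst c_prd) (auto intro!: sum.neutral simp: zero)
    show ?thesis
      by (auto simp: \<phi>_def F_def direct_sum_def matrix_alg_def null_alg_def fun_eq_iff low high)
  qed
  ultimately show ?thesis unfolding alg_iso_def F_def[symmetric] by blast
qed

theorem theorem4p2:
  fixes E :: "'a::ab_group_add calg" and n :: nat
  assumes "n \<ge> 1"
    and "evolution_algebra E"
    and "alg_dim E = n"
    and "nilpotent_alg E"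
    and "condition_P E"
  shows "\<exists>k (F :: (nat \<Rightarrow> complex) calg).
           1 \<le> k \<and> k \<le> n \<and> F \<in> ZN k \<and> E \<cong>\<^sub>a (F \<oplus>\<^sub>a null_alg (n - k))"
proof -
  interpret complex_algebra E using assms(2) by (simp add: evolution_algebra_def)
  obtain B where "natural_basis E B" using assms(2) by (auto simp: evolution_algebra_def)
  then interpret evolution_basis_P E B using assms(5) by unfold_locales
  have "\<exists>s. bij_betw s {1..card nonnull} nonnull \<and>
    (\<forall>i\<in>{1..card nonnull}. \<forall>j\<in>{1..card nonnull}. j \<le> i \<longrightarrow> \<not> coord (prd E (s i) (s i)) (s j) \<noteq> 0)"
    using sink_exists[OF assms(4)]
    by (intro ordering_from_sinks[where R = "\<lambda>t u. coord (prd E t t) u \<noteq> 0"] finite_nonnull) auto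
  then obtain s where s: "bij_betw s {1..card nonnull} nonnull"
    "\<And>i j. \<lbrakk>i \<in> {1..card nonnull}; j \<in> {1..card nonnull}; j \<le> i\<rbrakk> \<Longrightarrow> coord (prd E (s i) (s i)) (s j) = 0"
    by blast
  interpret ordered_evolution_basis E B s "card nonnull" by unfold_locales (use s in auto)
  have n: "dim (carr E) = n" using assms(3) by (simp add: alg_dim_def)
  obtain k f a where k: "1 \<le> k" "k \<le> n" and f: "structure_matrix E n f a"
    and zero: "\<And>i j. \<lbrakk>i \<in> {1..n}; j \<in> {1..n}; k \<le> i \<or> k < j \<or> j \<le> i\<rbrakk> \<Longrightarrow> a i j = 0"
    and diag: "\<And>i. 1 \<le> i \<Longrightarrow> i + 1 \<le> k \<Longrightarrow> a i (i + 1) \<noteq> 0"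
    and last: "\<And>i. 1 \<le> i \<Longrightarrow> i + 2 \<le> k \<Longrightarrow> a i k = 0"
    using ex_structure_matrix_superdiagonal[OF n assms(1)] by metis
  obtain l where l: "\<And>i. l i \<noteq> 0" "\<And>i. 1 \<le> i \<Longrightarrow> i < k \<Longrightarrow> l (Suc i) = (l i)\<^sup>2 * a i (Suc i)"
    using ex_diagonal_scaling[of k "\<lambda>i. a i (Suc i)"] diag by auto
  define b where "b = (\<lambda>i j. (l i)\<^sup>2 * a i j / l j)"
  have "structure_matrix E n (\<lambda>i. scl E (l i) (f i)) b"
    unfolding b_def using structure_matrix_rescale[OF f _ n] l by blast
  then have "E \<cong>\<^sub>a (matrix_alg k b \<oplus>\<^sub>a null_alg (n - k))"
    using k zero by (intro structure_matrix_iso) (auto simp: b_def)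
  moreover have "matrix_alg k b \<in> ZN k"
  proof -
    have "b i j = 0" if "i \<in> {1..k}" "j \<in> {1..k}" "j \<le> i" for i j
      using that k zero by (simp add: b_def)
    moreover have "b i (i + 1) = 1" if "1 \<le> i \<and> i + 1 \<le> k" for i
      using that l(2)[of i] l(1)[of "Suc i"] by (simp add: b_def)
    moreover have "b i k = 0" if "1 \<le> i \<and> i + 2 \<le> k" for i
      using that last by (simp add: b_def)
    ultimately show ?thesis
      unfolding ZN_def using matrix_alg_evolution[of k b] by blast
  qed
  ultimately show ?thesis using k by blast
qed

end
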